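(* The class of $\mathcal{S}$-algebras and the class of $\mathcal{S}'$-algebras are term-equivalent, via the term definitions $x*y:=\neg(x\Rightarrow\neg y)$ (from $\mathcal S$-algebras to $\mathcal S'$-algebras) and $\neg x:=x\Rightarrow 0$ (from $\mathcal S'$-algebras to $\mathcal S$-algebras).
   Context: Nelson's logic $\mathcal S$ is the sentential logic in the language $\langle\land,\lor,\Rightarrow,\neg,0\rangle$ (types $2,2,2,1,0$) given by the following Hilbert-style calculus. Abbreviations: $\phi\Leftrightarrow\psi:=(\phi\Rightarrow\psi)\land(\psi\Rightarrow\phi)$, $1:=\neg 0$, $\phi\Rightarrow^2\psi:=\phi\Rightarrow(\phi\Rightarrow\psi)$; for a finite (possibly empty) list $\Gamma=(\phi_1,\dots,\phi_n)$ of formulas, $\Gamma\Rightarrow\phi:=\phi_1\Rightarrow(\phi_2\Rightarrow(\cdots(\phi_n\Rightarrow\phi)\cdots))$ and $\Gamma\Rightarrow^2\phi:=\phi_1\Rightarrow^2(\phi_2\Rightarrow^2(\cdots(\phi_n\Rightarrow^2\phi)\cdots))$, both being $\phi$ if $\Gamma$ is empty. Axiom schemata: (A1) $\phi\Rightarrow\phi$; (A2) $0\Rightarrow\psi$; (A3) $\neg\phi\Rightarrow(\phi\Rightarrow0)$; (A4) $1$; (A5) $(\phi\Rightarrow\psi)\Leftrightarrow(\neg\psi\Rightarrow\neg\phi)$. Rule schemata (for all formulas and every finite list $\Gamma$), written "premisses / conclusion": (P) $\Gamma\Rightarrow(\phi\Rightarrow(\psi\Rightarrow\gamma))$ / $\Gamma\Rightarrow(\psi\Rightarrow(\phi\Rightarrow\gamma))$;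 (C) $\phi\Rightarrow(\phi\Rightarrow(\phi\Rightarrow\gamma))$ / $\phi\Rightarrow(\phi\Rightarrow\gamma)$; (E) $\Gamma\Rightarrow\phi$, $\phi\Rightarrow\gamma$ / $\Gamma\Rightarrow\gamma$; ($\Rightarrow$l) $\Gamma\Rightarrow\phi$, $\psi\Rightarrow\gamma$ / $\Gamma\Rightarrow((\phi\Rightarrow\psi)\Rightarrow\gamma)$; ($\Rightarrow$r) $\gamma$ / $\phi\Rightarrow\gamma$; ($\land$l1) $\phi\Rightarrow\gamma$ / $(\phi\land\psi)\Rightarrow\gamma$; ($\land$l2) $\psi\Rightarrow\gamma$ / $(\phi\land\psi)\Rightarrow\gamma$; ($\land$r) $\Gamma\Rightarrow\phi$, $\Gamma\Rightarrow\psi$ / $\Gamma\Rightarrow(\phi\land\psi)$; ($\lor$l1) $\phi\Rightarrow\gamma$, $\psi\Rightarrow\gamma$ / $(\phi\lor\psi)\Rightarrow\gamma$; ($\lor$l2) $\phi\Rightarrow^2\gamma$, $\psi\Rightarrow^2\gamma$ / $(\phi\lor\psi)\Rightarrow^2\gamma$; ($\lor$r1) $\Gamma\Rightarrow\phi$ / $\Gamma\Rightarrow(\phi\lor\psi)$; ($\lor$r2) $\Gamma\Rightarrow\psi$ / $\Gamma\Rightarrow(\phi\lor\psi)$; ($\neg\Rightarrow$l) $(\phi\land\neg\psi)\Rightarrow\gamma$ / $\neg(\phi\Rightarrow\psi)\Rightarrow\gamma$; ($\neg\Rightarrow$r) $\Gamma\Rightarrow^2(\phi\land\neg\psi)$ /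 $\Gamma\Rightarrow^2\neg(\phi\Rightarrow\psi)$; ($\neg\land$l) $(\neg\phi\lor\neg\psi)\Rightarrow\gamma$ / $\neg(\phi\land\psi)\Rightarrow\gamma$; ($\neg\land$r) $\Gamma\Rightarrow(\neg\phi\lor\neg\psi)$ / $\Gamma\Rightarrow\neg(\phi\land\psi)$; ($\neg\lor$l) $(\neg\phi\land\neg\psi)\Rightarrow\gamma$ / $\neg(\phi\lor\psi)\Rightarrow\gamma$; ($\neg\lor$r) $\Gamma\Rightarrow(\neg\phi\land\neg\psi)$ / $\Gamma\Rightarrow\neg(\phi\lor\psi)$; ($\neg\neg$l) $\phi\Rightarrow\gamma$ / $\neg\neg\phi\Rightarrow\gamma$; ($\neg\neg$r) $\Gamma\Rightarrow\phi$ / $\Gamma\Rightarrow\neg\neg\phi$. An $\mathcal S$-algebra is an algebra $\langle A,\land,\lor,\Rightarrow,\neg,0,1\rangle$ of type $\langle2,2,2,1,0,0\rangle$ satisfying: (i) $\varphi\approx1$ for every axiom (A1)–(A5) of $\mathcal S$, formulas being read as terms and the abbreviation $1:=\neg0$ of the logic written out (so (A4) gives $\neg0\approx1$); (ii) $x\Rightarrow x\approx1$; (iii) for each rule of $\mathcal S$ with premisses $\varphi_1,\dots,\varphi_n$ and conclusion $\varphi$, the quasi-equation $(\varphi_1\approx1\ \&\cdots\&\ \varphi_n\approx1)\Longrightarrow\varphi\approx1$; (iv) $(x\Rightarrow y\approx1\ \&\ y\Rightarrow x\approx1)\Longrightarrow x\approx y$. A commutative integral residuated lattice (CIRL) is an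 algebra $\langle A,\land,\lor,*,\Rightarrow,1\rangle$ such that $\langle A,\land,\lor\rangle$ is a lattice with top element $1$, $\langle A,*,1\rangle$ is a commutative monoid, and $a*b\le c$ iff $b\le a\Rightarrow c$. A CIBRL is a CIRL with an extra constant $0$ that is the least element; set $\neg a:=a\Rightarrow0$. It is involutive if $\neg\neg x\approx x$, and three-potent if $a*a\le a*a*a$ for all $a$. An $\mathcal S'$-algebra is a three-potent involutive CIBRL $\langle A,\land,\lor,*,\Rightarrow,0,1\rangle$. Two classes of algebras are term-equivalent when each operation of one is term-definable in the other so that the induced translations are mutually inverse bijections between the two classes. *)

theory Defs
  imports "HOL-Algebra.Group"
begin

section \<open>Algebras of a given type, terms, and term-equivalence of classes\<close>

text \<open>An algebra has an explicit carrier set and interprets every operation symbol as an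
  operation on tuples (lists). The type of the algebra is an arity function. An operation is
  required to be \<^const>\<open>undefined\<close> on everything that is not a tuple over the carrier of the right
  length, so that two algebras are equal in HOL iff they have the same carrier and the same
  operations on it.\<close>

record ('f, 'a) univ_algebra = "'a partial_object" +
  interp :: "'f \<Rightarrow> 'a list \<Rightarrow> 'a"

definition tuples :: "'a set \<Rightarrow> nat \<Rightarrow> 'a list set" where
  "tuples X n = {xs. length xs = n \<and> set xs \<subseteq> X}"

definition is_algebra :: "('f \<Rightarrow> nat) \<Rightarrow> ('f, 'a) univ_algebra \<Rightarrow> bool" where
  "is_algebra ar A \<longleftrightarrow>
     carrier A \<noteq> {} \<and> (\<forall>f. interp A f \<in> tuples (carrier A) (ar f) \<rightarrow>\<^sub>E carrier A)"

datatype 'f trm = Var nat | App 'f "'f trm list"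

primrec eval :: "('f, 'a) univ_algebra \<Rightarrow> (nat \<Rightarrow> 'a) \<Rightarrow> 'f trm \<Rightarrow> 'a" where
  "eval A v (Var i) = v i"
| "eval A v (App f ts) = interp A f (map (eval A v) ts)"

text \<open>\<open>trm_in ar n t\<close>: the term \<open>t\<close> respects the arities and its variables are among the first \<open>n\<close>.\<close>

inductive trm_in :: "('f \<Rightarrow> nat) \<Rightarrow> nat \<Rightarrow> 'f trm \<Rightarrow> bool" for ar n where
  "i < n \<Longrightarrow> trm_in ar n (Var i)"
| "length ts = ar f \<Longrightarrow> (\<And>t. t \<in> set ts \<Longrightarrow> trm_in ar n t) \<Longrightarrow> trm_in ar n (App f ts)"

text \<open>A system of term definitions assigns to each operation symbol \<open>g\<close> of the type \<open>arG\<close> a term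
  of the type \<open>arF\<close> in as many variables as the arity of \<open>g\<close>. It turns every algebra of type
  \<open>arF\<close> into one of type \<open>arG\<close> on the same carrier.\<close>

definition term_definitions ::
  "('f \<Rightarrow> nat) \<Rightarrow> ('g \<Rightarrow> nat) \<Rightarrow> ('g \<Rightarrow> 'f trm) \<Rightarrow> bool" where
  "term_definitions arF arG \<tau> \<longleftrightarrow> (\<forall>g. trm_in arF (arG g) (\<tau> g))"

definition translate ::
  "('g \<Rightarrow> nat) \<Rightarrow> ('g \<Rightarrow> 'f trm) \<Rightarrow> ('f, 'a) univ_algebra \<Rightarrow> ('g, 'a) univ_algebra" where
  "translate arG \<tau> A =
     \<lparr> carrier = carrier A,
       interp = (\<lambda>g. \<lambda>xs\<in>tuples (carrier A) (arG g). eval A (\<lambda>i. xs ! i) (\<tau> g)) \<rparr>"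

definition term_equivalent_via ::
  "('f \<Rightarrow> nat) \<Rightarrow> ('g \<Rightarrow> nat) \<Rightarrow> ('f, 'a) univ_algebra set \<Rightarrow> ('g, 'a) univ_algebra set \<Rightarrow>
   ('g \<Rightarrow> 'f trm) \<Rightarrow> ('f \<Rightarrow> 'g trm) \<Rightarrow> bool" where
  "term_equivalent_via arF arG K L \<tau> \<sigma> \<longleftrightarrow>
     term_definitions arF arG \<tau> \<and> term_definitions arG arF \<sigma> \<and>
     bij_betw (translate arG \<tau>) K L \<and> bij_betw (translate arF \<sigma>) L K \<and>
     (\<forall>A\<in>K. translate arF \<sigma> (translate arG \<tau> A) = A) \<and>
     (\<forall>B\<in>L. translate arG \<tau> (translate arF \<sigma> B) = B)"

section \<open>Nelson's logic S\<close>

datatype fm =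
    Atom nat
  | And fm fm  (infixr "\<^bold>\<and>" 65)
  | Or fm fm  (infixr "\<^bold>\<or>" 64)
  | Imp fm fm  (infixr "\<^bold>\<Rightarrow>" 60)
  | Neg fm  ("\<^bold>\<not> _" [70] 70)
  | Zero  ("\<^bold>0")

abbreviation Truth :: fm  ("\<^bold>1") where
  "\<^bold>1 \<equiv> \<^bold>\<not> \<^bold>0"

abbreviation Iff :: "fm \<Rightarrow> fm \<Rightarrow> fm"  (infix "\<^bold>\<Leftrightarrow>" 59) where
  "\<phi> \<^bold>\<Leftrightarrow> \<psi> \<equiv> (\<phi> \<^bold>\<Rightarrow> \<psi>) \<^bold>\<and> (\<psi> \<^bold>\<Rightarrow> \<phi>)"

abbreviation Imp2 :: "fm \<Rightarrow> fm \<Rightarrow> fm"  (infixr "\<^bold>\<Rightarrow>\<^sup>2" 60) where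
  "\<phi> \<^bold>\<Rightarrow>\<^sup>2 \<psi> \<equiv> \<phi> \<^bold>\<Rightarrow> (\<phi> \<^bold>\<Rightarrow> \<psi>)"

abbreviation Imps :: "fm list \<Rightarrow> fm \<Rightarrow> fm"  (infixr "\<^bold>\<Rightarrow>\<^sub>*" 60) where
  "\<Gamma> \<^bold>\<Rightarrow>\<^sub>* \<phi> \<equiv> foldr (\<lambda>\<psi> \<chi>. \<psi> \<^bold>\<Rightarrow> \<chi>) \<Gamma> \<phi>"

abbreviation Imps2 :: "fm list \<Rightarrow> fm \<Rightarrow> fm"  (infixr "\<^bold>\<Rightarrow>\<^sup>2\<^sub>*" 60) where
  "\<Gamma> \<^bold>\<Rightarrow>\<^sup>2\<^sub>* \<phi> \<equiv> foldr (\<lambda>\<psi> \<chi>. \<psi> \<^bold>\<Rightarrow>\<^sup>2 \<chi>) \<Gamma> \<phi>"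

inductive S_axiom :: "fm \<Rightarrow> bool" where
  A1: "S_axiom (\<phi> \<^bold>\<Rightarrow> \<phi>)"
| A2: "S_axiom (\<^bold>0 \<^bold>\<Rightarrow> \<psi>)"
| A3: "S_axiom (\<^bold>\<not> \<phi> \<^bold>\<Rightarrow> (\<phi> \<^bold>\<Rightarrow> \<^bold>0))"
| A4: "S_axiom \<^bold>1"
| A5: "S_axiom ((\<phi> \<^bold>\<Rightarrow> \<psi>) \<^bold>\<Leftrightarrow> (\<^bold>\<not> \<psi> \<^bold>\<Rightarrow> \<^bold>\<not> \<phi>))"

text \<open>\<open>S_rule \<Theta> \<phi>\<close>: the rule with the list \<open>\<Theta>\<close> of premisses and the conclusion \<open>\<phi>\<close> is an
  instance of one of the rule schemata.\<close>

inductive S_rule :: "fm list \<Rightarrow> fm \<Rightarrow> bool" where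
  P: "S_rule [\<Gamma> \<^bold>\<Rightarrow>\<^sub>* (\<phi> \<^bold>\<Rightarrow> (\<psi> \<^bold>\<Rightarrow> \<gamma>))] (\<Gamma> \<^bold>\<Rightarrow>\<^sub>* (\<psi> \<^bold>\<Rightarrow> (\<phi> \<^bold>\<Rightarrow> \<gamma>)))"
| C: "S_rule [\<phi> \<^bold>\<Rightarrow> (\<phi> \<^bold>\<Rightarrow> (\<phi> \<^bold>\<Rightarrow> \<gamma>))] (\<phi> \<^bold>\<Rightarrow> (\<phi> \<^bold>\<Rightarrow> \<gamma>))"
| E: "S_rule [\<Gamma> \<^bold>\<Rightarrow>\<^sub>* \<phi>, \<phi> \<^bold>\<Rightarrow> \<gamma>] (\<Gamma> \<^bold>\<Rightarrow>\<^sub>* \<gamma>)"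
| imp_l: "S_rule [\<Gamma> \<^bold>\<Rightarrow>\<^sub>* \<phi>, \<psi> \<^bold>\<Rightarrow> \<gamma>] (\<Gamma> \<^bold>\<Rightarrow>\<^sub>* ((\<phi> \<^bold>\<Rightarrow> \<psi>) \<^bold>\<Rightarrow> \<gamma>))"
| imp_r: "S_rule [\<gamma>] (\<phi> \<^bold>\<Rightarrow> \<gamma>)"
| and_l1: "S_rule [\<phi> \<^bold>\<Rightarrow> \<gamma>] ((\<phi> \<^bold>\<and> \<psi>) \<^bold>\<Rightarrow> \<gamma>)"
| and_l2: "S_rule [\<psi> \<^bold>\<Rightarrow> \<gamma>] ((\<phi> \<^bold>\<and> \<psi>) \<^bold>\<Rightarrow> \<gamma>)"
| and_r: "S_rule [\<Gamma> \<^bold>\<Rightarrow>\<^sub>* \<phi>, \<Gamma> \<^bold>\<Rightarrow>\<^sub>* \<psi>] (\<Gamma> \<^bold>\<Rightarrow>\<^sub>* (\<phi> \<^bold>\<and> \<psi>))"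
| or_l1: "S_rule [\<phi> \<^bold>\<Rightarrow> \<gamma>, \<psi> \<^bold>\<Rightarrow> \<gamma>] ((\<phi> \<^bold>\<or> \<psi>) \<^bold>\<Rightarrow> \<gamma>)"
| or_l2: "S_rule [\<phi> \<^bold>\<Rightarrow>\<^sup>2 \<gamma>, \<psi> \<^bold>\<Rightarrow>\<^sup>2 \<gamma>] ((\<phi> \<^bold>\<or> \<psi>) \<^bold>\<Rightarrow>\<^sup>2 \<gamma>)"
| or_r1: "S_rule [\<Gamma> \<^bold>\<Rightarrow>\<^sub>* \<phi>] (\<Gamma> \<^bold>\<Rightarrow>\<^sub>* (\<phi> \<^bold>\<or> \<psi>))"
| or_r2: "S_rule [\<Gamma> \<^bold>\<Rightarrow>\<^sub>* \<psi>] (\<Gamma> \<^bold>\<Rightarrow>\<^sub>* (\<phi> \<^bold>\<or> \<psi>))"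
| neg_imp_l: "S_rule [(\<phi> \<^bold>\<and> \<^bold>\<not> \<psi>) \<^bold>\<Rightarrow> \<gamma>] (\<^bold>\<not> (\<phi> \<^bold>\<Rightarrow> \<psi>) \<^bold>\<Rightarrow> \<gamma>)"
| neg_imp_r: "S_rule [\<Gamma> \<^bold>\<Rightarrow>\<^sup>2\<^sub>* (\<phi> \<^bold>\<and> \<^bold>\<not> \<psi>)] (\<Gamma> \<^bold>\<Rightarrow>\<^sup>2\<^sub>* \<^bold>\<not> (\<phi> \<^bold>\<Rightarrow> \<psi>))"
| neg_and_l: "S_rule [(\<^bold>\<not> \<phi> \<^bold>\<or> \<^bold>\<not> \<psi>) \<^bold>\<Rightarrow> \<gamma>] (\<^bold>\<not> (\<phi> \<^bold>\<and> \<psi>) \<^bold>\<Rightarrow> \<gamma>)"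
| neg_and_r: "S_rule [\<Gamma> \<^bold>\<Rightarrow>\<^sub>* (\<^bold>\<not> \<phi> \<^bold>\<or> \<^bold>\<not> \<psi>)] (\<Gamma> \<^bold>\<Rightarrow>\<^sub>* \<^bold>\<not> (\<phi> \<^bold>\<and> \<psi>))"
| neg_or_l: "S_rule [(\<^bold>\<not> \<phi> \<^bold>\<and> \<^bold>\<not> \<psi>) \<^bold>\<Rightarrow> \<gamma>] (\<^bold>\<not> (\<phi> \<^bold>\<or> \<psi>) \<^bold>\<Rightarrow> \<gamma>)"
| neg_or_r: "S_rule [\<Gamma> \<^bold>\<Rightarrow>\<^sub>* (\<^bold>\<not> \<phi> \<^bold>\<and> \<^bold>\<not> \<psi>)] (\<Gamma> \<^bold>\<Rightarrow>\<^sub>* \<^bold>\<not> (\<phi> \<^bold>\<or> \<psi>))"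
| neg_neg_l: "S_rule [\<phi> \<^bold>\<Rightarrow> \<gamma>] (\<^bold>\<not> (\<^bold>\<not> \<phi>) \<^bold>\<Rightarrow> \<gamma>)"
| neg_neg_r: "S_rule [\<Gamma> \<^bold>\<Rightarrow>\<^sub>* \<phi>] (\<Gamma> \<^bold>\<Rightarrow>\<^sub>* \<^bold>\<not> (\<^bold>\<not> \<phi>))"

section \<open>S-algebras\<close>

datatype S_op = SAnd | SOr | SImp | SNeg | SZero | SOne

primrec S_arity :: "S_op \<Rightarrow> nat" where
  "S_arity SAnd = 2"
| "S_arity SOr = 2"
| "S_arity SImp = 2"
| "S_arity SNeg = 1"
| "S_arity SZero = 0"
| "S_arity SOne = 0"

text \<open>The language of the logic has no symbol for 1, so \<^const>\<open>SOne\<close> does not occur in the terms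
  that come from formulas.\<close>

primrec trm_of :: "fm \<Rightarrow> S_op trm" where
  "trm_of (Atom i) = Var i"
| "trm_of (\<phi> \<^bold>\<and> \<psi>) = App SAnd [trm_of \<phi>, trm_of \<psi>]"
| "trm_of (\<phi> \<^bold>\<or> \<psi>) = App SOr [trm_of \<phi>, trm_of \<psi>]"
| "trm_of (\<phi> \<^bold>\<Rightarrow> \<psi>) = App SImp [trm_of \<phi>, trm_of \<psi>]"
| "trm_of (\<^bold>\<not> \<phi>) = App SNeg [trm_of \<phi>]"
| "trm_of \<^bold>0 = App SZero []"

definition S_algebras :: "(S_op, 'a) univ_algebra set" where
  "S_algebras = {A. is_algebra S_arity A \<and>
     (\<forall>\<phi>. S_axiom \<phi> \<longrightarrow>
        (\<forall>v \<in> UNIV \<rightarrow> carrier A. eval A v (trm_of \<phi>) = interp A SOne [])) \<and>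
     (\<forall>x \<in> carrier A. interp A SImp [x, x] = interp A SOne []) \<and>
     (\<forall>\<Theta> \<phi>. S_rule \<Theta> \<phi> \<longrightarrow>
        (\<forall>v \<in> UNIV \<rightarrow> carrier A.
           (\<forall>\<pi> \<in> set \<Theta>. eval A v (trm_of \<pi>) = interp A SOne []) \<longrightarrow>
           eval A v (trm_of \<phi>) = interp A SOne [])) \<and>
     (\<forall>x \<in> carrier A. \<forall>y \<in> carrier A.
        interp A SImp [x, y] = interp A SOne [] \<and> interp A SImp [y, x] = interp A SOne [] \<longrightarrow>
        x = y)}"

section \<open>Residuated lattices and S'-algebras\<close>

locale lattice_algebra =
  fixes A :: "'a set"
    and meet :: "'a \<Rightarrow> 'a \<Rightarrow> 'a"  (infixl "\<sqinter>" 70)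
    and join :: "'a \<Rightarrow> 'a \<Rightarrow> 'a"  (infixl "\<squnion>" 65)
  assumes meet_closed: "a \<in> A \<Longrightarrow> b \<in> A \<Longrightarrow> a \<sqinter> b \<in> A"
    and join_closed: "a \<in> A \<Longrightarrow> b \<in> A \<Longrightarrow> a \<squnion> b \<in> A"
    and meet_commute: "a \<in> A \<Longrightarrow> b \<in> A \<Longrightarrow> a \<sqinter> b = b \<sqinter> a"
    and join_commute: "a \<in> A \<Longrightarrow> b \<in> A \<Longrightarrow> a \<squnion> b = b \<squnion> a"
    and meet_assoc: "a \<in> A \<Longrightarrow> b \<in> A \<Longrightarrow> c \<in> A \<Longrightarrow> (a \<sqinter> b) \<sqinter> c = a \<sqinter> (b \<sqinter> c)"
    and join_assoc: "a \<in> A \<Longrightarrow> b \<in> A \<Longrightarrow> c \<in> A \<Longrightarrow> (a \<squnion> b) \<squnion> c = a \<squnion> (b \<squnion> c)"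
    and meet_absorb: "a \<in> A \<Longrightarrow> b \<in> A \<Longrightarrow> a \<sqinter> (a \<squnion> b) = a"
    and join_absorb: "a \<in> A \<Longrightarrow> b \<in> A \<Longrightarrow> a \<squnion> (a \<sqinter> b) = a"
begin

definition le :: "'a \<Rightarrow> 'a \<Rightarrow> bool"  (infix "\<preceq>" 50) where
  "a \<preceq> b \<longleftrightarrow> a \<sqinter> b = a"

end

locale cirl = lattice_algebra A meet join
  for A :: "'a set"
    and meet :: "'a \<Rightarrow> 'a \<Rightarrow> 'a"  (infixl "\<sqinter>" 70)
    and join :: "'a \<Rightarrow> 'a \<Rightarrow> 'a"  (infixl "\<squnion>" 65) +
  fixes fuse :: "'a \<Rightarrow> 'a \<Rightarrow> 'a"  (infixl "\<star>" 75)
    and res :: "'a \<Rightarrow> 'a \<Rightarrow> 'a"  (infixr "\<rightharpoonup>" 60)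
    and one :: 'a
  assumes res_closed: "a \<in> A \<Longrightarrow> b \<in> A \<Longrightarrow> a \<rightharpoonup> b \<in> A"
    and fuse_comm_monoid: "comm_monoid \<lparr> carrier = A, monoid.mult = (\<star>), one = one \<rparr>"
    and one_top: "a \<in> A \<Longrightarrow> a \<preceq> one"
    and residuation:
      "a \<in> A \<Longrightarrow> b \<in> A \<Longrightarrow> c \<in> A \<Longrightarrow> a \<star> b \<preceq> c \<longleftrightarrow> b \<preceq> (a \<rightharpoonup> c)"

locale cibrl = cirl A meet join fuse res one
  for A :: "'a set" and meet join
    and fuse (infixl "\<star>" 75)
    and res (infixr "\<rightharpoonup>" 60)
    and one +
  fixes zero :: 'a
  assumes zero_closed: "zero \<in> A"
    and zero_least: "a \<in> A \<Longrightarrow> zero \<preceq> a"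
begin

definition neg :: "'a \<Rightarrow> 'a" where
  "neg a = (a \<rightharpoonup> zero)"

end

locale three_potent_involutive_cibrl = cibrl A meet join fuse res one zero
  for A :: "'a set" and meet join
    and fuse (infixl "\<star>" 75)
    and res one zero +
  assumes involutive: "a \<in> A \<Longrightarrow> neg (neg a) = a"
    and three_potent: "a \<in> A \<Longrightarrow> a \<star> a \<preceq> a \<star> a \<star> a"

datatype S'_op = Meet | Join | Fuse | Res | Bot | Top

primrec S'_arity :: "S'_op \<Rightarrow> nat" where
  "S'_arity Meet = 2"
| "S'_arity Join = 2"
| "S'_arity Fuse = 2"
| "S'_arity Res = 2"
| "S'_arity Bot = 0"
| "S'_arity Top = 0"

definition S'_algebras :: "(S'_op, 'a) univ_algebra set" where
  "S'_algebras = {A. is_algebra S'_arity A \<and>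
     three_potent_involutive_cibrl (carrier A)
       (\<lambda>x y. interp A Meet [x, y]) (\<lambda>x y. interp A Join [x, y])
       (\<lambda>x y. interp A Fuse [x, y]) (\<lambda>x y. interp A Res [x, y])
       (interp A Top []) (interp A Bot [])}"

section \<open>The term definitions\<close>

primrec S'_op_in_S :: "S'_op \<Rightarrow> S_op trm" where
  "S'_op_in_S Meet = App SAnd [Var 0, Var 1]"
| "S'_op_in_S Join = App SOr [Var 0, Var 1]"
| "S'_op_in_S Fuse = App SNeg [App SImp [Var 0, App SNeg [Var 1]]]"
| "S'_op_in_S Res = App SImp [Var 0, Var 1]"
| "S'_op_in_S Bot = App SZero []"
| "S'_op_in_S Top = App SOne []"

primrec S_op_in_S' :: "S_op \<Rightarrow> S'_op trm" where
  "S_op_in_S' SAnd = App Meet [Var 0, Var 1]"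
| "S_op_in_S' SOr = App Join [Var 0, Var 1]"
| "S_op_in_S' SImp = App Res [Var 0, Var 1]"
| "S_op_in_S' SNeg = App Res [Var 0, App Bot []]"
| "S_op_in_S' SZero = App Bot []"
| "S_op_in_S' SOne = App Top []"

end

theory Submission
  imports Defs
begin

text \<open>In an S-algebra, \<open>x \<Rightarrow> y = 1\<close> is a lattice order, and exchange together with contraposition
  gives \<open>(x * y) \<Rightarrow> z = x \<Rightarrow> (y \<Rightarrow> z)\<close> for \<open>x * y = \<not> (x \<Rightarrow> \<not> y)\<close>, which is residuation and also
  yields associativity. Conversely, in a three-potent involutive CIBRL the formula \<open>\<Gamma> \<Rightarrow> \<phi>\<close> takes
  the value \<open>p \<Rightarrow> \<phi>\<close> with \<open>p\<close> the product of \<open>\<Gamma>\<close>, and \<open>\<Gamma> \<Rightarrow>\<^sup>2 \<phi>\<close> the value \<open>p\<^sup>2 \<Rightarrow> \<phi>\<close>. Three-potency makes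
  \<open>p\<^sup>2\<close> idempotent and \<open>(x \<or> y)\<^sup>2 = (x \<or> y)\<^sup>3\<close>; these two facts validate the rules that involve \<open>\<Rightarrow>\<^sup>2\<close>.\<close>

section \<open>Term translations\<close>

lemma tuples_0 [simp]: "xs \<in> tuples X 0 \<longleftrightarrow> xs = []"
  by (auto simp: tuples_def)

lemma tuples_1 [simp]: "[x] \<in> tuples X (Suc 0) \<longleftrightarrow> x \<in> X"
  by (auto simp: tuples_def)

lemma tuples_2 [simp]: "[x, y] \<in> tuples X 2 \<longleftrightarrow> x \<in> X \<and> y \<in> X"
  by (auto simp: tuples_def)

lemma tuples_1E:
  assumes "xs \<in> tuples X (Suc 0)"
  obtains x where "xs = [x]" "x \<in> X"
  using assms by (auto simp: tuples_def length_Suc_conv)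

lemma tuples_2E:
  assumes "xs \<in> tuples X 2"
  obtains x y where "xs = [x, y]" "x \<in> X" "y \<in> X"
  using assms by (auto simp: tuples_def length_Suc_conv numeral_2_eq_2)

lemma is_algebra_closed:
  assumes "is_algebra ar A" "xs \<in> tuples (carrier A) (ar f)"
  shows "interp A f xs \<in> carrier A"
  using assms by (auto simp: is_algebra_def PiE_def)

lemma is_algebra_undefined:
  assumes "is_algebra ar A" "xs \<notin> tuples (carrier A) (ar f)"
  shows "interp A f xs = undefined"
  using assms by (auto simp: is_algebra_def PiE_def extensional_def)

lemma eval_closed:
  assumes "is_algebra ar A" "trm_in ar n t" "\<And>i. i < n \<Longrightarrow> v i \<in> carrier A"
  shows "eval A v t \<in> carrier A"
  using assms(2)
proof (induction t rule: trm_in.induct)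
  case (1 i)
  then show ?case using assms(3) by simp
next
  case (2 ts f)
  then show ?case
    by (auto simp: tuples_def intro!: is_algebra_closed[OF assms(1)])
qed

lemma carrier_translate [simp]: "carrier (translate arG \<tau> A) = carrier A"
  by (simp add: translate_def)

lemma is_algebra_translate:
  assumes "is_algebra arF A" "term_definitions arF arG \<tau>"
  shows "is_algebra arG (translate arG \<tau> A)"
proof -
  have "eval A (\<lambda>i. xs ! i) (\<tau> g) \<in> carrier A" if "xs \<in> tuples (carrier A) (arG g)" for g xs
    using assms that by (auto simp: term_definitions_def tuples_def intro!: eval_closed)
  moreover have "carrier A \<noteq> {}"
    using assms(1) by (simp add: is_algebra_def)
  ultimately show ?thesis
    by (auto simp: is_algebra_def translate_def PiE_def)
qed

text \<open>Off the tuples over the common carrier both interpretations are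
  \<open>undefined\<close>, so agreement on tuples already makes the records equal.\<close>

lemma algebra_eqI:
  fixes A B :: "('f, 'a) univ_algebra"
  assumes "is_algebra ar A" "is_algebra ar B" "carrier A = carrier B"
    and "\<And>f xs. xs \<in> tuples (carrier B) (ar f) \<Longrightarrow> interp A f xs = interp B f xs"
  shows "A = B"
proof -
  have "interp A f xs = interp B f xs" for f xs
    using assms is_algebra_undefined[of ar A xs f] is_algebra_undefined[of ar B xs f]
    by (cases "xs \<in> tuples (carrier B) (ar f)") auto
  then have "interp A = interp B" by blast
  with assms(3) show ?thesis by (cases A, cases B) auto
qed

text \<open>Each translation is the witness inverse for the other, so both bijections follow from
  the two round trips once the images are known to lie in the right classes.\<close>

lemma term_equivalent_viaI:
  assumes "term_definitions arF arG \<tau>" "term_definitions arG arF \<sigma>"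
    and "\<And>A. A \<in> K \<Longrightarrow> translate arG \<tau> A \<in> L" "\<And>B. B \<in> L \<Longrightarrow> translate arF \<sigma> B \<in> K"
    and "\<And>A. A \<in> K \<Longrightarrow> translate arF \<sigma> (translate arG \<tau> A) = A"
    and "\<And>B. B \<in> L \<Longrightarrow> translate arG \<tau> (translate arF \<sigma> B) = B"
  shows "term_equivalent_via arF arG K L \<tau> \<sigma>"
  unfolding term_equivalent_via_def
  using assms
  by (auto intro!: bij_betw_byWitness[where f' = "translate arF \<sigma>"]
      bij_betw_byWitness[where f' = "translate arG \<tau>"])

lemma term_definitions_S' [simp]: "term_definitions S_arity S'_arity S'_op_in_S"
  unfolding term_definitions_def
proof
  fix g show "trm_in S_arity (S'_arity g) (S'_op_in_S g)"
    by (cases g) (auto intro!: trm_in.intros)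
qed

lemma term_definitions_S [simp]: "term_definitions S'_arity S_arity S_op_in_S'"
  unfolding term_definitions_def
proof
  fix g show "trm_in S'_arity (S_arity g) (S_op_in_S' g)"
    by (cases g) (auto intro!: trm_in.intros)
qed

no_notation Lattice.meet (infixl "\<sqinter>\<index>" 70) and Lattice.join (infixl "\<squnion>\<index>" 65)

section \<open>From S-algebras to residuated lattices\<close>

text \<open>The product is a parameter determined on the carrier only, because the product of a translated
  algebra is \<^const>\<open>undefined\<close> elsewhere.\<close>

locale nelson_algebra =
  fixes A :: "'a set"
    and meet :: "'a \<Rightarrow> 'a \<Rightarrow> 'a"  (infixl "\<sqinter>" 70)
    and join :: "'a \<Rightarrow> 'a \<Rightarrow> 'a"  (infixl "\<squnion>" 65)
    and imp :: "'a \<Rightarrow> 'a \<Rightarrow> 'a"  (infixr "\<rightharpoonup>" 60)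
    and neg :: "'a \<Rightarrow> 'a"
    and fuse :: "'a \<Rightarrow> 'a \<Rightarrow> 'a"  (infixl "\<star>" 75)
    and zero one :: 'a
  assumes closed [simp]:
    "x \<in> A \<Longrightarrow> y \<in> A \<Longrightarrow> x \<sqinter> y \<in> A" "x \<in> A \<Longrightarrow> y \<in> A \<Longrightarrow> x \<squnion> y \<in> A"
    "x \<in> A \<Longrightarrow> y \<in> A \<Longrightarrow> x \<rightharpoonup> y \<in> A" "x \<in> A \<Longrightarrow> neg x \<in> A" "zero \<in> A" "one \<in> A"
    and imp_refl [simp]: "x \<in> A \<Longrightarrow> x \<rightharpoonup> x = one"
    and imp_antisym: "x \<in> A \<Longrightarrow> y \<in> A \<Longrightarrow> x \<rightharpoonup> y = one \<Longrightarrow> y \<rightharpoonup> x = one \<Longrightarrow> x = y"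
    and imp_trans: "x \<in> A \<Longrightarrow> y \<in> A \<Longrightarrow> z \<in> A \<Longrightarrow>
        x \<rightharpoonup> y = one \<Longrightarrow> y \<rightharpoonup> z = one \<Longrightarrow> x \<rightharpoonup> z = one"
    and zero_imp: "x \<in> A \<Longrightarrow> zero \<rightharpoonup> x = one"
    and imp_one: "x \<in> A \<Longrightarrow> x \<rightharpoonup> one = one"
    and one_imp: "x \<in> A \<Longrightarrow> one \<rightharpoonup> x = x"
    and exchange: "x \<in> A \<Longrightarrow> y \<in> A \<Longrightarrow> z \<in> A \<Longrightarrow> x \<rightharpoonup> y \<rightharpoonup> z = y \<rightharpoonup> x \<rightharpoonup> z"
    and contraction: "x \<in> A \<Longrightarrow> y \<in> A \<Longrightarrow> x \<rightharpoonup> x \<rightharpoonup> x \<rightharpoonup> y = one \<Longrightarrow> x \<rightharpoonup> x \<rightharpoonup> y = one"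
    and neg_zero: "neg zero = one"
    and neg_neg [simp]: "x \<in> A \<Longrightarrow> neg (neg x) = x"
    and contraposition: "x \<in> A \<Longrightarrow> y \<in> A \<Longrightarrow> neg y \<rightharpoonup> neg x = x \<rightharpoonup> y"
    and meet_imp: "x \<in> A \<Longrightarrow> y \<in> A \<Longrightarrow> x \<sqinter> y \<rightharpoonup> x = one" "x \<in> A \<Longrightarrow> y \<in> A \<Longrightarrow> x \<sqinter> y \<rightharpoonup> y = one"
    and imp_meet: "x \<in> A \<Longrightarrow> y \<in> A \<Longrightarrow> z \<in> A \<Longrightarrow>
        z \<rightharpoonup> x = one \<Longrightarrow> z \<rightharpoonup> y = one \<Longrightarrow> z \<rightharpoonup> x \<sqinter> y = one"
    and imp_join: "x \<in> A \<Longrightarrow> y \<in> A \<Longrightarrow> x \<rightharpoonup> x \<squnion> y = one" "x \<in> A \<Longrightarrow> y \<in> A \<Longrightarrow> y \<rightharpoonup> x \<squnion> y = one"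
    and join_imp: "x \<in> A \<Longrightarrow> y \<in> A \<Longrightarrow> z \<in> A \<Longrightarrow>
        x \<rightharpoonup> z = one \<Longrightarrow> y \<rightharpoonup> z = one \<Longrightarrow> x \<squnion> y \<rightharpoonup> z = one"
    and fuse_def: "x \<in> A \<Longrightarrow> y \<in> A \<Longrightarrow> x \<star> y = neg (x \<rightharpoonup> neg y)"
begin

section \<open>The product defined from implication and negation\<close>

lemma fuse_closed [simp]: "x \<in> A \<Longrightarrow> y \<in> A \<Longrightarrow> x \<star> y \<in> A"
  by (simp add: fuse_def)

text \<open>Contraposition turns \<open>x \<rightharpoonup> zero\<close> into
  \<open>one \<rightharpoonup> neg x\<close>. Hence the primitive negation is the one of a
  residuated lattice, and it survives the round trip.\<close>

lemma neg_eq_imp_zero: "x \<in> A \<Longrightarrow> x \<rightharpoonup> zero = neg x"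
  using contraposition[of x zero] by (simp add: neg_zero one_imp)

lemma imp_neg_commute: "x \<in> A \<Longrightarrow> y \<in> A \<Longrightarrow> x \<rightharpoonup> neg y = y \<rightharpoonup> neg x"
  using contraposition[of y "neg x"] by simp

text \<open>Contrapose to \<open>neg z \<rightharpoonup> x \<rightharpoonup> neg y\<close>, let
  exchange bring \<open>x\<close> to the front, and contrapose the inner implication back.\<close>

lemma fuse_imp:
  assumes "x \<in> A" "y \<in> A" "z \<in> A"
  shows "x \<star> y \<rightharpoonup> z = x \<rightharpoonup> y \<rightharpoonup> z"
proof -
  have "x \<star> y \<rightharpoonup> z = neg z \<rightharpoonup> x \<rightharpoonup> neg y"
    using assms contraposition[of "x \<star> y" z] by (simp add: fuse_def)
  also have "\<dots> = x \<rightharpoonup> y \<rightharpoonup> z"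
    using assms by (simp add: exchange[of "neg z" x] contraposition)
  finally show ?thesis .
qed

lemma fuse_commute: "x \<in> A \<Longrightarrow> y \<in> A \<Longrightarrow> x \<star> y = y \<star> x"
  by (simp add: fuse_def imp_neg_commute)

text \<open>Currying brings both sides to
  \<open>neg (x \<rightharpoonup> y \<rightharpoonup> neg z)\<close>.\<close>

lemma fuse_assoc:
  assumes "x \<in> A" "y \<in> A" "z \<in> A"
  shows "(x \<star> y) \<star> z = x \<star> (y \<star> z)"
proof -
  have "(x \<star> y) \<star> z = neg (x \<rightharpoonup> y \<rightharpoonup> neg z)"
    using assms by (simp add: fuse_imp fuse_def[of "x \<star> y"])
  also have "\<dots> = x \<star> (y \<star> z)"
    using assms by (simp add: fuse_def)
  finally show ?thesis .
qed

lemma one_fuse: "x \<in> A \<Longrightarrow> one \<star> x = x"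
  by (simp add: fuse_def one_imp)

section \<open>Lattice order, residuation and three-potency\<close>

lemma meet_eq_iff_imp:
  assumes "x \<in> A" "y \<in> A"
  shows "x \<sqinter> y = x \<longleftrightarrow> x \<rightharpoonup> y = one"
proof
  assume "x \<sqinter> y = x"
  then show "x \<rightharpoonup> y = one" using assms meet_imp(2)[of x y] by simp
next
  assume "x \<rightharpoonup> y = one"
  then show "x \<sqinter> y = x"
    using assms by - (rule imp_antisym, simp_all add: meet_imp imp_meet)
qed

lemma lattice: "lattice_algebra A (\<sqinter>) (\<squnion>)"
proof
  fix a b assume ab: "a \<in> A" "b \<in> A"
  show "a \<sqinter> b \<in> A" "a \<squnion> b \<in> A" using ab by auto
  show "a \<sqinter> b = b \<sqinter> a" using ab by - (rule imp_antisym, simp_all add: meet_imp imp_meet)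
  show "a \<squnion> b = b \<squnion> a" using ab by - (rule imp_antisym, simp_all add: join_imp imp_join)
  show "a \<sqinter> (a \<squnion> b) = a" using ab by (simp add: meet_eq_iff_imp imp_join)
  show "a \<squnion> (a \<sqinter> b) = a" using ab by - (rule imp_antisym, simp_all add: join_imp imp_join meet_imp)
  fix c assume c: "c \<in> A"
  note abc = ab c
  \<comment> \<open>These are the bounds that pass through an inner meet and so need transitivity;
    the outer ones are instances of \<open>meet_imp\<close>.\<close>
  have m: "a \<sqinter> b \<sqinter> c \<rightharpoonup> a = one" "a \<sqinter> b \<sqinter> c \<rightharpoonup> b = one" "a \<sqinter> (b \<sqinter> c) \<rightharpoonup> b = one"
    "a \<sqinter> (b \<sqinter> c) \<rightharpoonup> c = one"
    using abc imp_trans[of "a \<sqinter> b \<sqinter> c" "a \<sqinter> b"] imp_trans[of "a \<sqinter> (b \<sqinter> c)" "b \<sqinter> c"]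
    by (simp_all add: meet_imp)
  show "a \<sqinter> b \<sqinter> c = a \<sqinter> (b \<sqinter> c)"
    using abc m by - (rule imp_antisym, simp_all add: imp_meet meet_imp)
  have j: "a \<rightharpoonup> a \<squnion> b \<squnion> c = one" "b \<rightharpoonup> a \<squnion> b \<squnion> c = one" "b \<rightharpoonup> a \<squnion> (b \<squnion> c) = one"
    "c \<rightharpoonup> a \<squnion> (b \<squnion> c) = one"
    using abc imp_trans[of _ "a \<squnion> b" "a \<squnion> b \<squnion> c"] imp_trans[of _ "b \<squnion> c" "a \<squnion> (b \<squnion> c)"]
    by (simp_all add: imp_join)
  show "a \<squnion> b \<squnion> c = a \<squnion> (b \<squnion> c)"
    using abc j by - (rule imp_antisym, simp_all add: join_imp imp_join)
qed

lemma le_iff_imp: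
  "x \<in> A \<Longrightarrow> y \<in> A \<Longrightarrow> lattice_algebra.le (\<sqinter>) x y \<longleftrightarrow> x \<rightharpoonup> y = one"
  by (simp add: lattice_algebra.le_def[OF lattice] meet_eq_iff_imp)

lemma cibrl: "cibrl A (\<sqinter>) (\<squnion>) (\<star>) (\<rightharpoonup>) one zero"
proof (intro cibrl.intro cirl.intro lattice cirl_axioms.intro cibrl_axioms.intro)
  show "comm_monoid \<lparr>carrier = A, monoid.mult = (\<star>), one = one\<rparr>"
    by (rule comm_monoidI) (auto simp: fuse_assoc one_fuse intro: fuse_commute)
  \<comment> \<open>After currying, the two sides say that
    \<open>a \<rightharpoonup> b \<rightharpoonup> c\<close> and
    \<open>b \<rightharpoonup> a \<rightharpoonup> c\<close> equal \<open>one\<close>, which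
    exchange identifies.\<close>
  fix a b c assume "a \<in> A" "b \<in> A" "c \<in> A"
  then show "lattice_algebra.le (\<sqinter>) (a \<star> b) c \<longleftrightarrow> lattice_algebra.le (\<sqinter>) b (a \<rightharpoonup> c)"
    by (simp add: le_iff_imp fuse_imp exchange)
qed (auto simp: le_iff_imp imp_one zero_imp)

lemma three_potent_involutive_cibrl:
  "three_potent_involutive_cibrl A (\<sqinter>) (\<squnion>) (\<star>) (\<rightharpoonup>) one zero"
proof (intro three_potent_involutive_cibrl.intro cibrl three_potent_involutive_cibrl_axioms.intro)
  fix a assume a: "a \<in> A"
  show "cibrl.neg (\<rightharpoonup>) zero (cibrl.neg (\<rightharpoonup>) zero a) = a"
    using a by (simp add: cibrl.neg_def[OF cibrl] neg_eq_imp_zero)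
  \<comment> \<open>Contraction is applied with the cube of \<open>a\<close> as its consequent; its
    premiss is reflexivity of the cube in curried form.\<close>
  have "a \<rightharpoonup> a \<rightharpoonup> a \<rightharpoonup> a \<star> a \<star> a = a \<star> a \<star> a \<rightharpoonup> a \<star> a \<star> a"
    using a by (simp only: fuse_imp closed fuse_closed)
  then have "a \<rightharpoonup> a \<rightharpoonup> a \<star> a \<star> a = one"
    using a contraction[of a "a \<star> a \<star> a"] by simp
  then show "lattice_algebra.le (\<sqinter>) (a \<star> a) (a \<star> a \<star> a)"
    using a by (simp add: le_iff_imp fuse_imp)
qed

end

section \<open>Laws extracted from the axioms and rules of the logic\<close>

lemma S_algebra_axiom:
  assumes "A \<in> S_algebras" "S_axiom \<phi>" "range v \<subseteq> carrier A"
  shows "eval A v (trm_of \<phi>) = interp A SOne []"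
proof -
  have "v \<in> UNIV \<rightarrow> carrier A" using assms(3) by auto
  then show ?thesis using assms(1,2) unfolding S_algebras_def by blast
qed

lemma S_algebra_rule:
  assumes "A \<in> S_algebras" "S_rule \<Theta> \<phi>" "range v \<subseteq> carrier A"
    and "\<And>\<pi>. \<pi> \<in> set \<Theta> \<Longrightarrow> eval A v (trm_of \<pi>) = interp A SOne []"
  shows "eval A v (trm_of \<phi>) = interp A SOne []"
proof -
  have "v \<in> UNIV \<rightarrow> carrier A" using assms(3) by auto
  then show ?thesis using assms(1,2,4) unfolding S_algebras_def by blast
qed

text \<open>The laws come from instances of axioms and rules in at most three atoms; an equation
  comes from two implications with value \<open>one\<close> and antisymmetry.\<close>

lemma nelson_algebra_of_S_algebra:
  fixes A :: "(S_op, 'a) univ_algebra"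
  assumes A: "A \<in> S_algebras"
    and fuse: "\<And>x y. x \<in> carrier A \<Longrightarrow> y \<in> carrier A \<Longrightarrow>
      fuse x y = interp A SNeg [interp A SImp [x, interp A SNeg [y]]]"
  shows "nelson_algebra (carrier A) (\<lambda>x y. interp A SAnd [x, y]) (\<lambda>x y. interp A SOr [x, y])
    (\<lambda>x y. interp A SImp [x, y]) (\<lambda>x. interp A SNeg [x]) fuse
    (interp A SZero []) (interp A SOne [])"
proof -
  let ?A = "carrier A"
  define one where "one = interp A SOne []"
  define zero where "zero = interp A SZero []"
  define meet where "meet = (\<lambda>x y. interp A SAnd [x, y])"
  define join where "join = (\<lambda>x y. interp A SOr [x, y])"
  define imp where "imp = (\<lambda>x y. interp A SImp [x, y])"
  define neg where "neg = (\<lambda>x. interp A SNeg [x])"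
  note defs = one_def zero_def meet_def join_def imp_def neg_def
  \<comment> \<open>Every atom other than the first two gets the value \<open>z\<close>, so
    \<open>?c\<close> does as well and the range stays within the three given elements.\<close>
  define v where "v x y z = (\<lambda>i. if i = 0 then x else if i = Suc 0 then y else z)" for x y z :: 'a
  let ?a = "Atom 0" and ?b = "Atom (Suc 0)" and ?c = "Atom 2"
  have ev: "eval A w (trm_of (Atom i)) = w i"
    "eval A w (trm_of (\<phi> \<^bold>\<and> \<psi>)) = meet (eval A w (trm_of \<phi>)) (eval A w (trm_of \<psi>))"
    "eval A w (trm_of (\<phi> \<^bold>\<or> \<psi>)) = join (eval A w (trm_of \<phi>)) (eval A w (trm_of \<psi>))"
    "eval A w (trm_of (\<phi> \<^bold>\<Rightarrow> \<psi>)) = imp (eval A w (trm_of \<phi>)) (eval A w (trm_of \<psi>))"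
    "eval A w (trm_of (\<^bold>\<not> \<phi>)) = neg (eval A w (trm_of \<phi>))"
    "eval A w (trm_of \<^bold>0) = zero" for w i \<phi> \<psi>
    by (simp_all add: defs)
  have alg: "is_algebra S_arity A" using A unfolding S_algebras_def by blast
  have cl: "meet x y \<in> ?A" "join x y \<in> ?A" "imp x y \<in> ?A"
    if "x \<in> ?A" "y \<in> ?A" for x y
    using that by (simp_all add: defs is_algebra_closed[OF alg])
  have cl_neg: "neg x \<in> ?A" if "x \<in> ?A" for x
    using that by (simp add: defs is_algebra_closed[OF alg])
  have cl0: "zero \<in> ?A" "one \<in> ?A"
    by (simp_all add: defs is_algebra_closed[OF alg])
  have vc: "range (v x y z) \<subseteq> ?A" if "x \<in> ?A" "y \<in> ?A" "z \<in> ?A" for x y z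
    using that by (auto simp: v_def)
  have refl: "imp x x = one" if "x \<in> ?A" for x
    using A that unfolding S_algebras_def defs by blast
  have antisym: "x = y" if "x \<in> ?A" "y \<in> ?A" "imp x y = one" "imp y x = one" for x y
    using A that unfolding S_algebras_def defs by blast
  have ax: "eval A (v x y z) (trm_of \<phi>) = one"
    if "x \<in> ?A" "y \<in> ?A" "z \<in> ?A" "S_axiom \<phi>" for x y z \<phi>
    using S_algebra_axiom[OF A that(4) vc[OF that(1-3)]] by (simp add: one_def)
  have rule: "eval A (v x y z) (trm_of \<phi>) = one"
    if "x \<in> ?A" "y \<in> ?A" "z \<in> ?A" "S_rule \<Theta> \<phi>"
      "\<forall>\<pi>\<in>set \<Theta>. eval A (v x y z) (trm_of \<pi>) = one" for x y z \<Theta> \<phi>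
    using S_algebra_rule[OF A that(4) vc[OF that(1-3)]] that(5) by (simp add: one_def)
  note evs = ev v_def
  note [simp del] = trm_of.simps eval.simps
  have trans: "imp x z = one"
    if "x \<in> ?A" "y \<in> ?A" "z \<in> ?A" "imp x y = one" "imp y z = one" for x y z
    using rule[OF that(1-3) E[of "[?a]" ?b ?c]] that(4,5) by (simp add: evs)
  have zero_imp: "imp zero x = one" if "x \<in> ?A" for x
    using ax[OF that that that A2[of ?a]] by (simp add: evs)
  have neg_zero: "neg zero = one"
    using ax[OF cl0(1) cl0(1) cl0(1) A4] by (simp add: ev)
  have imp_one: "imp x one = one" if "x \<in> ?A" for x
    using rule[OF that cl0(2) cl0(2) imp_r[of ?b ?a]] by (simp add: evs)
  have exchange_le: "imp (imp x (imp y z)) (imp y (imp x z)) = one"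
    if "x \<in> ?A" "y \<in> ?A" "z \<in> ?A" for x y z
    \<comment> \<open>Taking the formula to be permuted as the only member of the context makes the
      premiss of P an instance of reflexivity.\<close>
    using rule[OF that P[of "[?a \<^bold>\<Rightarrow> ?b \<^bold>\<Rightarrow> ?c]" ?a ?b ?c]] that by (simp add: evs refl cl)
  have exchange: "imp x (imp y z) = imp y (imp x z)" if "x \<in> ?A" "y \<in> ?A" "z \<in> ?A" for x y z
    using that by - (rule antisym, simp_all add: exchange_le cl)
  have one_imp: "imp one x = x" if x: "x \<in> ?A" for x
  proof (rule antisym)
    show "imp (imp one x) x = one"
      \<comment> \<open>With an empty context the first premiss is the bare formula
        \<open>?a\<close>, which holds because its value is \<open>one\<close>.\<close>
      using rule[OF cl0(2) x x imp_l[of "[]" ?a ?b ?b]] x by (simp add: evs refl)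
    show "imp x (imp one x) = one"
      \<comment> \<open>Exchange rewrites the goal to
        \<open>imp one (imp x x) = one\<close>.\<close>
      using x cl0 exchange[of x one x] by (simp add: refl imp_one)
  qed (use x cl0 cl in auto)
  have contraction: "imp x (imp x y) = one"
    if "x \<in> ?A" "y \<in> ?A" "imp x (imp x (imp x y)) = one" for x y
    using rule[OF that(1,2,2) C[of ?a ?b]] that(3) by (simp add: evs)
  have meet_le: "imp (meet x y) x = one" "imp (meet x y) y = one" if "x \<in> ?A" "y \<in> ?A" for x y
    using rule[OF that that(2) and_l1[of ?a ?a ?b]] rule[OF that that(2) and_l2[of ?b ?b ?a]] that
    by (simp_all add: evs refl)
  have le_meet: "imp z (meet x y) = one"
    if "x \<in> ?A" "y \<in> ?A" "z \<in> ?A" "imp z x = one" "imp z y = one" for x y z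
    using rule[OF that(1-3) and_r[of "[?c]" ?a ?b]] that(4,5) by (simp add: evs)
  have le_join: "imp x (join x y) = one" "imp y (join x y) = one" if "x \<in> ?A" "y \<in> ?A" for x y
    using rule[OF that that(2) or_r1[of "[?a]" ?a ?b]] rule[OF that that(2) or_r2[of "[?b]" ?b ?a]] that
    by (simp_all add: evs refl)
  have join_le: "imp (join x y) z = one"
    if "x \<in> ?A" "y \<in> ?A" "z \<in> ?A" "imp x z = one" "imp y z = one" for x y z
    using rule[OF that(1-3) or_l1[of ?a ?c ?b]] that(4,5) by (simp add: evs)
  have neg_neg: "neg (neg x) = x" if x: "x \<in> ?A" for x
  proof (rule antisym)
    show "imp (neg (neg x)) x = one"
      using rule[OF x x x neg_neg_l[of ?a ?a]] x by (simp add: evs refl)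
    show "imp x (neg (neg x)) = one"
      using rule[OF x x x neg_neg_r[of "[?a]" ?a]] x by (simp add: evs refl)
  qed (use x cl_neg in auto)
  \<comment> \<open>This splits the biconditional of A5: if a meet is \<open>one\<close>, then
    \<open>one\<close> implies each part, and \<open>one_imp\<close> makes each part
    \<open>one\<close>.\<close>
  have meet_one: "x = one \<and> y = one" if "x \<in> ?A" "y \<in> ?A" "meet x y = one" for x y
    using that meet_le[of x y] by (auto simp: one_imp)
  have contraposition: "imp (neg y) (neg x) = imp x y" if "x \<in> ?A" "y \<in> ?A" for x y
  proof -
    have "meet (imp (imp x y) (imp (neg y) (neg x))) (imp (imp (neg y) (neg x)) (imp x y)) = one"
      using ax[OF that that(2) A5[of ?a ?b]] by (simp add: evs)
    from meet_one[OF _ _ this] show ?thesis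
      using that by - (rule antisym, simp_all add: cl cl_neg)
  qed
  have fuse_eq: "fuse x y = neg (imp x (neg y))" if "x \<in> ?A" "y \<in> ?A" for x y
    using fuse[OF that] by (simp add: defs)
  have "nelson_algebra ?A meet join imp neg fuse zero one"
    by (rule nelson_algebra.intro; fact cl cl_neg cl0 refl antisym trans zero_imp imp_one one_imp exchange contraction
        neg_zero neg_neg contraposition meet_le le_meet le_join join_le fuse_eq)
  then show ?thesis by (simp only: defs)
qed

section \<open>From residuated lattices to S-algebras\<close>

context lattice_algebra
begin

text \<open>Absorption of \<open>a \<squnion> (a \<sqinter> a)\<close> under a meet with
  \<open>a\<close>, where that join is itself \<open>a\<close> by the dual absorption law.\<close>

lemma meet_idem: "a \<in> A \<Longrightarrow> a \<sqinter> a = a"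
  using meet_absorb[of a "a \<sqinter> a"] join_absorb[of a a] by (simp add: meet_closed)

lemma le_refl: "a \<in> A \<Longrightarrow> a \<preceq> a"
  by (simp add: le_def meet_idem)

lemma le_antisym: "a \<in> A \<Longrightarrow> b \<in> A \<Longrightarrow> a \<preceq> b \<Longrightarrow> b \<preceq> a \<Longrightarrow> a = b"
  by (metis le_def meet_commute)

lemma le_trans: "a \<preceq> b \<Longrightarrow> b \<preceq> c \<Longrightarrow> a \<in> A \<Longrightarrow> b \<in> A \<Longrightarrow> c \<in> A \<Longrightarrow> a \<preceq> c"
  by (metis le_def meet_assoc)

lemma meet_le1: "a \<in> A \<Longrightarrow> b \<in> A \<Longrightarrow> a \<sqinter> b \<preceq> a"
  unfolding le_def by (metis meet_assoc meet_commute meet_idem)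

lemma meet_le2: "a \<in> A \<Longrightarrow> b \<in> A \<Longrightarrow> a \<sqinter> b \<preceq> b"
  unfolding le_def by (metis meet_assoc meet_idem)

lemma le_meet: "c \<preceq> a \<Longrightarrow> c \<preceq> b \<Longrightarrow> a \<in> A \<Longrightarrow> b \<in> A \<Longrightarrow> c \<in> A \<Longrightarrow> c \<preceq> a \<sqinter> b"
  unfolding le_def by (metis meet_assoc)

lemma le_iff_join: "a \<in> A \<Longrightarrow> b \<in> A \<Longrightarrow> a \<preceq> b \<longleftrightarrow> a \<squnion> b = b"
  unfolding le_def by (metis meet_absorb join_absorb meet_commute join_commute)

lemma le_join1: "a \<in> A \<Longrightarrow> b \<in> A \<Longrightarrow> a \<preceq> a \<squnion> b"
  by (simp add: le_def meet_absorb)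

lemma le_join2: "a \<in> A \<Longrightarrow> b \<in> A \<Longrightarrow> b \<preceq> a \<squnion> b"
  using le_join1[of b a] by (simp add: join_commute)

lemma join_le: "a \<preceq> c \<Longrightarrow> b \<preceq> c \<Longrightarrow> a \<in> A \<Longrightarrow> b \<in> A \<Longrightarrow> c \<in> A \<Longrightarrow> a \<squnion> b \<preceq> c"
  by (simp add: le_iff_join join_closed join_assoc)

end

section \<open>Arithmetic of commutative integral residuated lattices\<close>

context cirl
begin

lemma fuse_closed: "a \<in> A \<Longrightarrow> b \<in> A \<Longrightarrow> a \<star> b \<in> A"
  using monoid.m_closed[OF comm_monoid.axioms(1)[OF fuse_comm_monoid]] by simp

lemma one_closed: "one \<in> A"
  using monoid.one_closed[OF comm_monoid.axioms(1)[OF fuse_comm_monoid]] by simp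

lemmas ops_closed [simp] = meet_closed join_closed fuse_closed res_closed one_closed

lemma fuse_assoc: "a \<in> A \<Longrightarrow> b \<in> A \<Longrightarrow> c \<in> A \<Longrightarrow> a \<star> b \<star> c = a \<star> (b \<star> c)"
  using monoid.m_assoc[OF comm_monoid.axioms(1)[OF fuse_comm_monoid]] by simp

lemma fuse_commute: "a \<in> A \<Longrightarrow> b \<in> A \<Longrightarrow> a \<star> b = b \<star> a"
  using comm_monoid.m_comm[OF fuse_comm_monoid] by simp

lemma fuse_left_commute: "a \<in> A \<Longrightarrow> b \<in> A \<Longrightarrow> c \<in> A \<Longrightarrow> a \<star> (b \<star> c) = b \<star> (a \<star> c)"
  by (metis fuse_assoc fuse_commute)

lemmas fuse_ac = fuse_assoc fuse_commute fuse_left_commute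

lemma one_fuse [simp]: "a \<in> A \<Longrightarrow> one \<star> a = a"
  using monoid.l_one[OF comm_monoid.axioms(1)[OF fuse_comm_monoid]] by simp

lemma fuse_one [simp]: "a \<in> A \<Longrightarrow> a \<star> one = a"
  using monoid.r_one[OF comm_monoid.axioms(1)[OF fuse_comm_monoid]] by simp

text \<open>An element is determined by its lower bounds. Residuation describes the lower bounds of
  a residual, so identities between residuals reduce to identities of the monoid.\<close>

lemma eqI_le:
  assumes "a \<in> A" "b \<in> A" "\<And>c. c \<in> A \<Longrightarrow> c \<preceq> a \<longleftrightarrow> c \<preceq> b"
  shows "a = b"
  using assms by (meson le_antisym le_refl)

lemma one_le_iff: "a \<in> A \<Longrightarrow> one \<preceq> a \<longleftrightarrow> a = one"
  using le_antisym le_refl one_closed one_top by blast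

text \<open>Residuation at the unit, which is also the top. It translates validity of an implication
  into the order and drives the soundness proof.\<close>

lemma res_eq_one_iff [simp]: "a \<in> A \<Longrightarrow> b \<in> A \<Longrightarrow> a \<rightharpoonup> b = one \<longleftrightarrow> a \<preceq> b"
  using residuation[of a one b] by (simp add: one_le_iff)

lemma one_res [simp]: "a \<in> A \<Longrightarrow> one \<rightharpoonup> a = a"
  by (rule eqI_le) (auto simp flip: residuation)

lemma fuse_res: "a \<in> A \<Longrightarrow> b \<in> A \<Longrightarrow> c \<in> A \<Longrightarrow> a \<star> b \<rightharpoonup> c = a \<rightharpoonup> b \<rightharpoonup> c"
  by (rule eqI_le) (auto simp: fuse_ac simp flip: residuation)

lemma fuse_mono:
  assumes "a \<preceq> b" "c \<preceq> d" and [simp]: "a \<in> A" "b \<in> A" "c \<in> A" "d \<in> A"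
  shows "a \<star> c \<preceq> b \<star> d"
proof -
  have mono: "x \<star> z \<preceq> y \<star> z" if "x \<preceq> y" "x \<in> A" "y \<in> A" "z \<in> A" for x y z
  proof -
    \<comment> \<open>The unit of the adjunction between product and residual; transitivity then
      carries \<open>x\<close> below the residual.\<close>
    have "y \<preceq> z \<rightharpoonup> y \<star> z"
      using that by (simp add: le_refl fuse_commute[of z y] flip: residuation)
    then have "x \<preceq> z \<rightharpoonup> y \<star> z"
      using that le_trans by (metis fuse_closed res_closed)
    then show ?thesis
      using that by (simp add: fuse_commute[of x z] residuation)
  qed
  have "b \<star> c \<preceq> b \<star> d"
    using mono[of c d b] assms by (simp add: fuse_commute)
  with mono[of a b c] show ?thesis
    using assms le_trans by (meson fuse_closed)
qed

text \<open>Integrality: monotonicity applied to \<open>b \<preceq> one\<close>.\<close>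

lemma fuse_le1: "a \<in> A \<Longrightarrow> b \<in> A \<Longrightarrow> a \<star> b \<preceq> a"
  using fuse_mono[of a a b one] by (simp add: le_refl one_top)

lemma fuse_le2: "a \<in> A \<Longrightarrow> b \<in> A \<Longrightarrow> a \<star> b \<preceq> b"
  using fuse_le1[of b a] by (simp add: fuse_commute)

lemma modus_ponens_le: "a \<in> A \<Longrightarrow> b \<in> A \<Longrightarrow> a \<star> (a \<rightharpoonup> b) \<preceq> b"
  by (simp add: residuation le_refl)

text \<open>Residuation moves \<open>c\<close> to the right, where the claim is the
  least-upper-bound property. This is the useful half of distributivity of the product over
  joins.\<close>

lemma join_fuse_le:
  assumes "a \<star> c \<preceq> d" "b \<star> c \<preceq> d" and [simp]: "a \<in> A" "b \<in> A" "c \<in> A" "d \<in> A"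
  shows "(a \<squnion> b) \<star> c \<preceq> d"
proof -
  have "a \<preceq> c \<rightharpoonup> d" "b \<preceq> c \<rightharpoonup> d"
    using assms by (simp_all add: fuse_commute[of _ c] flip: residuation)
  then have "a \<squnion> b \<preceq> c \<rightharpoonup> d" by (intro join_le) auto
  then show ?thesis by (simp add: fuse_commute[of _ c] residuation)
qed

end

section \<open>Consequences of involution and three-potency\<close>

context three_potent_involutive_cibrl
begin

notation meet (infixl "\<sqinter>" 70) and join (infixl "\<squnion>" 65) and res (infixr "\<rightharpoonup>" 60)

lemma zero_closed' [simp]: "zero \<in> A"
  by (rule zero_closed)

lemma neg_closed [simp]: "a \<in> A \<Longrightarrow> neg a \<in> A"
  by (simp add: neg_def)

text \<open>Both sides say that the product of \<open>a\<close> and \<open>b\<close> is below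
  \<open>zero\<close>.\<close>

lemma le_neg_commute: "a \<in> A \<Longrightarrow> b \<in> A \<Longrightarrow> a \<preceq> neg b \<longleftrightarrow> b \<preceq> neg a"
  unfolding neg_def by (metis residuation fuse_commute zero_closed)

lemma neg_le_commute: "a \<in> A \<Longrightarrow> b \<in> A \<Longrightarrow> neg a \<preceq> b \<longleftrightarrow> neg b \<preceq> a"
  using le_neg_commute[of "neg a" "neg b"] by (simp add: involutive)

text \<open>Currying with consequent \<open>zero\<close>. Together with involution it recovers the
  product as \<open>neg (a \<rightharpoonup> neg b)\<close>.\<close>

lemma res_neg: "a \<in> A \<Longrightarrow> b \<in> A \<Longrightarrow> a \<rightharpoonup> neg b = neg (a \<star> b)"
  by (simp add: neg_def fuse_res)

lemma neg_res: "a \<in> A \<Longrightarrow> b \<in> A \<Longrightarrow> neg (a \<rightharpoonup> b) = a \<star> neg b"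
  using res_neg[of a "neg b"] by (simp add: involutive)

lemma contraposition: "a \<in> A \<Longrightarrow> b \<in> A \<Longrightarrow> neg b \<rightharpoonup> neg a = a \<rightharpoonup> b"
  by (metis neg_res res_neg neg_closed involutive fuse_commute res_closed)

text \<open>An order-reversing involution exchanges meets and joins.\<close>

lemma neg_meet: "a \<in> A \<Longrightarrow> b \<in> A \<Longrightarrow> neg (a \<sqinter> b) = neg a \<squnion> neg b"
proof (rule le_antisym)
  assume [simp]: "a \<in> A" "b \<in> A"
  have "neg (neg a \<squnion> neg b) \<preceq> a \<sqinter> b"
    by (intro le_meet) (simp_all add: neg_le_commute[of "neg a \<squnion> neg b"] le_join1 le_join2)
  then show "neg (a \<sqinter> b) \<preceq> neg a \<squnion> neg b"
    by (simp add: neg_le_commute[of "a \<sqinter> b"])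
  show "neg a \<squnion> neg b \<preceq> neg (a \<sqinter> b)"
    by (intro join_le) (simp_all add: le_neg_commute[of _ "a \<sqinter> b"] involutive meet_le1 meet_le2)
qed auto

lemma neg_join: "a \<in> A \<Longrightarrow> b \<in> A \<Longrightarrow> neg (a \<squnion> b) = neg a \<sqinter> neg b"
  using neg_meet[of "neg a" "neg b"] by (metis involutive neg_closed meet_closed)

text \<open>Multiplying three-potency by \<open>a\<close> gives that the cube lies below the fourth
  power; chaining with three-potency itself reaches the square.\<close>

lemma square_idem:
  assumes [simp]: "a \<in> A"
  shows "a \<star> a \<preceq> (a \<star> a) \<star> (a \<star> a)"
proof -
  have "a \<star> a \<star> a \<preceq> a \<star> a \<star> a \<star> a"
    by (intro fuse_mono three_potent) (simp_all add: le_refl)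
  then have "a \<star> a \<preceq> a \<star> a \<star> a \<star> a"
    using le_trans[OF three_potent] by simp
  then show ?thesis by (simp add: fuse_assoc)
qed

text \<open>By three-potency it suffices to bound the cube of the join. Expanding it gives products
  of three letters \<open>a\<close> or \<open>b\<close>; one letter occurs twice, so each product is
  below a square and hence below \<open>c\<close>.\<close>

lemma join_square_le:
  assumes "a \<star> a \<preceq> c" "b \<star> b \<preceq> c" and [simp]: "a \<in> A" "b \<in> A" "c \<in> A"
  shows "(a \<squnion> b) \<star> (a \<squnion> b) \<preceq> c"
proof -
  let ?j = "a \<squnion> b"
  have aa: "a \<star> (a \<star> x) \<preceq> c" and bb: "b \<star> (b \<star> x) \<preceq> c" if "x \<in> A" for x
    using that assms le_trans[OF fuse_le1[of "a \<star> a" x]] le_trans[OF fuse_le1[of "b \<star> b" x]]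
    by (simp_all add: fuse_assoc)
  \<comment> \<open>The mixed prefix has no repeated letter yet; expanding the remaining factor
    repeats \<open>a\<close> or \<open>b\<close>.\<close>
  have ab: "a \<star> (b \<star> ?j) \<preceq> c"
  proof -
    have "?j \<star> (a \<star> b) \<preceq> c"
      using aa[of b] bb[of a] by (intro join_fuse_le) (simp_all add: fuse_ac)
    then show ?thesis by (simp add: fuse_ac)
  qed
  have "?j \<star> (a \<star> ?j) \<preceq> c" "?j \<star> (b \<star> ?j) \<preceq> c"
    using aa[of ?j] bb[of ?j] ab by (auto intro!: join_fuse_le simp: fuse_left_commute[of b a])
  then have "?j \<star> (?j \<star> ?j) \<preceq> c"
    using join_fuse_le[of a "?j \<star> ?j" c b]
    by (simp add: fuse_left_commute[of a ?j] fuse_left_commute[of b ?j])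
  then show ?thesis
    using le_trans[OF three_potent[of ?j]] by (simp add: fuse_assoc)
qed

section \<open>Soundness of the axioms and rules\<close>

primrec fm_val :: "(nat \<Rightarrow> 'a) \<Rightarrow> fm \<Rightarrow> 'a" where
  "fm_val v (Atom i) = v i"
| "fm_val v (\<phi> \<^bold>\<and> \<psi>) = fm_val v \<phi> \<sqinter> fm_val v \<psi>"
| "fm_val v (\<phi> \<^bold>\<or> \<psi>) = fm_val v \<phi> \<squnion> fm_val v \<psi>"
| "fm_val v (\<phi> \<^bold>\<Rightarrow> \<psi>) = (fm_val v \<phi> \<rightharpoonup> fm_val v \<psi>)"
| "fm_val v (\<^bold>\<not> \<phi>) = neg (fm_val v \<phi>)"
| "fm_val v \<^bold>0 = zero"

lemma fm_val_closed: "range v \<subseteq> A \<Longrightarrow> fm_val v \<phi> \<in> A"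
  by (induction \<phi>) auto

text \<open>The witness \<open>p\<close> does not depend on the succedent, so premisses and
  conclusion over the same context are compared through the same \<open>p\<close>. The empty context
  gives \<open>one\<close>.\<close>

lemma fm_val_Imps:
  assumes "range v \<subseteq> A"
  obtains p where "p \<in> A" "\<And>\<phi>. fm_val v (\<Gamma> \<^bold>\<Rightarrow>\<^sub>* \<phi>) = p \<rightharpoonup> fm_val v \<phi>"
proof (induction \<Gamma> arbitrary: thesis)
  case Nil
  show ?case by (rule Nil[of one]) (simp_all add: fm_val_closed[OF assms])
next
  case (Cons \<psi> \<Gamma>)
  from Cons.IH obtain p where "p \<in> A" "\<And>\<phi>. fm_val v (\<Gamma> \<^bold>\<Rightarrow>\<^sub>* \<phi>) = p \<rightharpoonup> fm_val v \<phi>" by blast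
  then show ?case
    by (intro Cons.prems[of "fm_val v \<psi> \<star> p"]) (simp_all add: fm_val_closed[OF assms] fuse_res)
qed

lemma fm_val_Imps2:
  assumes "range v \<subseteq> A"
  obtains p where "p \<in> A" "\<And>\<phi>. fm_val v (\<Gamma> \<^bold>\<Rightarrow>\<^sup>2\<^sub>* \<phi>) = p \<star> p \<rightharpoonup> fm_val v \<phi>"
proof (induction \<Gamma> arbitrary: thesis)
  case Nil
  show ?case by (rule Nil[of one]) (simp_all add: fm_val_closed[OF assms])
next
  case (Cons \<psi> \<Gamma>)
  from Cons.IH obtain p where p: "p \<in> A" "\<And>\<phi>. fm_val v (\<Gamma> \<^bold>\<Rightarrow>\<^sup>2\<^sub>* \<phi>) = p \<star> p \<rightharpoonup> fm_val v \<phi>"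
    by blast
  let ?q = "fm_val v \<psi>"
  \<comment> \<open>Each member of the context is used twice; commutativity gathers the copies into
    the square of one product.\<close>
  have "(?q \<star> p) \<star> (?q \<star> p) = ?q \<star> (?q \<star> (p \<star> p))"
    using p by (simp add: fm_val_closed[OF assms] fuse_ac)
  with p show ?case
    by (intro Cons.prems[of "?q \<star> p"]) (simp_all add: fm_val_closed[OF assms] fuse_res)
qed

lemma fm_val_axiom:
  assumes "S_axiom \<phi>" and v: "range v \<subseteq> A"
  shows "fm_val v \<phi> = one"
  using assms(1)
proof cases
  case (A3 \<phi>)
  then show ?thesis by (simp add: fm_val_closed[OF v] le_refl flip: neg_def)
next
  case A4
  then show ?thesis by (simp add: neg_def le_refl)
next
  \<comment> \<open>By contraposition both directions are the same reflexive implication, so the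
    meet is that of \<open>one\<close> with itself.\<close>
  case (A5 \<phi> \<psi>)
  then show ?thesis
    by (simp add: fm_val_closed[OF v] contraposition le_refl meet_idem iffD2[OF res_eq_one_iff])
qed (simp_all add: fm_val_closed[OF v] zero_least le_refl)

text \<open>Each rule becomes an inequality with the context condensed to \<open>p\<close>.
  Three-potency enters for C directly, for \<open>or_l2\<close> through
  \<open>join_square_le\<close>, and for \<open>neg_imp_r\<close> through
  \<open>square_idem\<close>.\<close>

lemma fm_val_rule:
  assumes "S_rule \<Theta> \<phi>" and v: "range v \<subseteq> A" and "\<forall>\<pi>\<in>set \<Theta>. fm_val v \<pi> = one"
  shows "fm_val v \<phi> = one"
  using assms(1,3)
proof cases
  note [simp] = fm_val_closed[OF v]
  have le_res: "a \<preceq> b \<rightharpoonup> c \<longleftrightarrow> b \<star> a \<preceq> c" if "a \<in> A" "b \<in> A" "c \<in> A" for a b c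
    using that by (simp add: residuation)
  {
    case (P \<Gamma> \<phi> \<psi> \<gamma>)
    obtain p where "p \<in> A" "\<And>\<phi>. fm_val v (\<Gamma> \<^bold>\<Rightarrow>\<^sub>* \<phi>) = p \<rightharpoonup> fm_val v \<phi>"
      using fm_val_Imps[OF v, where \<Gamma> = \<Gamma>] by blast
    then show ?thesis using P assms(3) by (simp add: le_res fuse_ac)
  next
    case (C \<phi> \<gamma>)
    let ?a = "fm_val v \<phi>"
    have "?a \<star> ?a \<star> ?a \<preceq> fm_val v \<gamma>"
      using C assms(3) by (simp add: le_res fuse_ac)
    then have "?a \<star> ?a \<preceq> fm_val v \<gamma>"
      using le_trans[OF three_potent] by simp
    then show ?thesis using C by (simp add: le_res)
  next
    case (E \<Gamma> \<phi> \<gamma>)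
    obtain p where "p \<in> A" "\<And>\<phi>. fm_val v (\<Gamma> \<^bold>\<Rightarrow>\<^sub>* \<phi>) = p \<rightharpoonup> fm_val v \<phi>"
      using fm_val_Imps[OF v, where \<Gamma> = \<Gamma>] by blast
    then show ?thesis using E assms(3) le_trans[of p "fm_val v \<phi>" "fm_val v \<gamma>"] by simp
  next
    case (imp_l \<Gamma> \<phi> \<psi> \<gamma>)
    obtain p where p: "p \<in> A" "\<And>\<phi>. fm_val v (\<Gamma> \<^bold>\<Rightarrow>\<^sub>* \<phi>) = p \<rightharpoonup> fm_val v \<phi>"
      using fm_val_Imps[OF v, where \<Gamma> = \<Gamma>] by blast
    let ?a = "fm_val v \<phi>" and ?b = "fm_val v \<psi>" and ?c = "fm_val v \<gamma>"
    \<comment> \<open>The first premiss gives \<open>p \<preceq> ?a\<close>, so the residual can be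
      discharged by modus ponens.\<close>
    have "p \<star> (?a \<rightharpoonup> ?b) \<preceq> ?a \<star> (?a \<rightharpoonup> ?b)"
      using imp_l p assms(3) by (intro fuse_mono) (simp_all add: le_refl)
    then have "p \<star> (?a \<rightharpoonup> ?b) \<preceq> ?b"
      using p le_trans[OF _ modus_ponens_le] by simp
    then have "p \<star> (?a \<rightharpoonup> ?b) \<preceq> ?c"
      using imp_l p assms(3) le_trans[of _ ?b ?c] by simp
    then show ?thesis using imp_l p by (simp add: le_res fuse_commute)
  next
    case (imp_r \<gamma> \<phi>)
    then show ?thesis using assms(3) by (simp add: one_top)
  next
    case (and_l1 \<phi> \<gamma> \<psi>)
    then show ?thesis
      using assms(3) le_trans[OF meet_le1[of "fm_val v \<phi>" "fm_val v \<psi>"]] by simp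
  next
    case (and_l2 \<psi> \<gamma> \<phi>)
    then show ?thesis
      using assms(3) le_trans[OF meet_le2[of "fm_val v \<phi>" "fm_val v \<psi>"]] by simp
  next
    case (and_r \<Gamma> \<phi> \<psi>)
    obtain p where "p \<in> A" "\<And>\<phi>. fm_val v (\<Gamma> \<^bold>\<Rightarrow>\<^sub>* \<phi>) = p \<rightharpoonup> fm_val v \<phi>"
      using fm_val_Imps[OF v, where \<Gamma> = \<Gamma>] by blast
    then show ?thesis using and_r assms(3) by (simp add: le_meet)
  next
    case (or_l1 \<phi> \<gamma> \<psi>)
    then show ?thesis using assms(3) by (simp add: join_le)
  next
    case (or_l2 \<phi> \<gamma> \<psi>)
    then show ?thesis using assms(3) by (simp add: le_res join_square_le)
  next
    case (or_r1 \<Gamma> \<phi> \<psi>)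
    obtain p where "p \<in> A" "\<And>\<phi>. fm_val v (\<Gamma> \<^bold>\<Rightarrow>\<^sub>* \<phi>) = p \<rightharpoonup> fm_val v \<phi>"
      using fm_val_Imps[OF v, where \<Gamma> = \<Gamma>] by blast
    then show ?thesis using or_r1 assms(3) le_trans[OF _ le_join1] by simp
  next
    case (or_r2 \<Gamma> \<psi> \<phi>)
    obtain p where "p \<in> A" "\<And>\<phi>. fm_val v (\<Gamma> \<^bold>\<Rightarrow>\<^sub>* \<phi>) = p \<rightharpoonup> fm_val v \<phi>"
      using fm_val_Imps[OF v, where \<Gamma> = \<Gamma>] by blast
    then show ?thesis using or_r2 assms(3) le_trans[OF _ le_join2] by simp
  next
    case (neg_imp_l \<phi> \<psi> \<gamma>)
    let ?a = "fm_val v \<phi>" and ?b = "fm_val v \<psi>"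
    \<comment> \<open>The negated implication has the value \<open>?a \<star> neg ?b\<close>, which
      integrality puts below the meet of the premiss.\<close>
    have "?a \<star> neg ?b \<preceq> ?a \<sqinter> neg ?b"
      by (intro le_meet fuse_le1 fuse_le2) simp_all
    then show ?thesis
      using neg_imp_l assms(3) le_trans[of _ "?a \<sqinter> neg ?b"] by (simp add: neg_res)
  next
    case (neg_imp_r \<Gamma> \<phi> \<psi>)
    let ?a = "fm_val v \<phi>" and ?b = "fm_val v \<psi>"
    obtain p where p: "p \<in> A" "\<And>\<phi>. fm_val v (\<Gamma> \<^bold>\<Rightarrow>\<^sup>2\<^sub>* \<phi>) = p \<star> p \<rightharpoonup> fm_val v \<phi>"
      using fm_val_Imps2[OF v, where \<Gamma> = \<Gamma>] by blast
    have le: "p \<star> p \<preceq> ?a \<sqinter> neg ?b"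
      using neg_imp_r assms(3) p by simp
    \<comment> \<open>The premiss bounds only a meet, while the conclusion needs a product: one copy
      of the square goes to each factor, and \<open>square_idem\<close> pays for the second
      copy.\<close>
    have "(p \<star> p) \<star> (p \<star> p) \<preceq> ?a \<star> neg ?b"
      using p le_trans[OF le meet_le1] le_trans[OF le meet_le2] by (intro fuse_mono) simp_all
    with square_idem[of p] have "p \<star> p \<preceq> ?a \<star> neg ?b"
      using p le_trans[of "p \<star> p" "(p \<star> p) \<star> (p \<star> p)"] by simp
    then show ?thesis using neg_imp_r p by (simp add: neg_res)
  next
    case (neg_and_l \<phi> \<psi> \<gamma>)
    then show ?thesis using assms(3) by (simp add: neg_meet)
  next
    case (neg_and_r \<Gamma> \<phi> \<psi>)
    obtain p where "p \<in> A" "\<And>\<phi>. fm_val v (\<Gamma> \<^bold>\<Rightarrow>\<^sub>* \<phi>) = p \<rightharpoonup> fm_val v \<phi>"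
      using fm_val_Imps[OF v, where \<Gamma> = \<Gamma>] by blast
    then show ?thesis using neg_and_r assms(3) by (simp add: neg_meet)
  next
    case (neg_or_l \<phi> \<psi> \<gamma>)
    then show ?thesis using assms(3) by (simp add: neg_join)
  next
    case (neg_or_r \<Gamma> \<phi> \<psi>)
    obtain p where "p \<in> A" "\<And>\<phi>. fm_val v (\<Gamma> \<^bold>\<Rightarrow>\<^sub>* \<phi>) = p \<rightharpoonup> fm_val v \<phi>"
      using fm_val_Imps[OF v, where \<Gamma> = \<Gamma>] by blast
    then show ?thesis using neg_or_r assms(3) by (simp add: neg_join)
  next
    case (neg_neg_l \<phi> \<gamma>)
    then show ?thesis using assms(3) by (simp add: involutive)
  next
    case (neg_neg_r \<Gamma> \<phi>)
    obtain p where "p \<in> A" "\<And>\<phi>. fm_val v (\<Gamma> \<^bold>\<Rightarrow>\<^sub>* \<phi>) = p \<rightharpoonup> fm_val v \<phi>"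
      using fm_val_Imps[OF v, where \<Gamma> = \<Gamma>] by blast
    then show ?thesis using neg_neg_r assms(3) by (simp add: involutive)
  }
qed

end

section \<open>The term-equivalence\<close>

lemma is_algebra_S: "A \<in> S_algebras \<Longrightarrow> is_algebra S_arity A"
  unfolding S_algebras_def by blast

lemma is_algebra_S': "B \<in> S'_algebras \<Longrightarrow> is_algebra S'_arity B"
  unfolding S'_algebras_def by blast

text \<open>For the basic binary operations both sides are \<open>undefined\<close> off the carrier,
  so the equations hold everywhere and rewrite under abstractions. The nested term for
  \<open>Fuse\<close> need not be \<open>undefined\<close> there, hence its restriction to the
  carrier.\<close>

lemma interp_S'_of_S:
  fixes A :: "(S_op, 'a) univ_algebra"
  assumes A: "is_algebra S_arity A"
  defines "B \<equiv> translate S'_arity S'_op_in_S A"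
  shows "interp B Meet [x, y] = interp A SAnd [x, y]"
    and "interp B Join [x, y] = interp A SOr [x, y]"
    and "interp B Res [x, y] = interp A SImp [x, y]"
    and "interp B Bot [] = interp A SZero []"
    and "interp B Top [] = interp A SOne []"
    and "x \<in> carrier A \<Longrightarrow> y \<in> carrier A \<Longrightarrow>
      interp B Fuse [x, y] = interp A SNeg [interp A SImp [x, interp A SNeg [y]]]"
proof -
  have "interp A f [x, y] = undefined"
    if "\<not> (x \<in> carrier A \<and> y \<in> carrier A)" "S_arity f = 2" for f
    using that by (intro is_algebra_undefined[OF A]) simp
  then show "interp B Meet [x, y] = interp A SAnd [x, y]" "interp B Join [x, y] = interp A SOr [x, y]"
    "interp B Res [x, y] = interp A SImp [x, y]"
    by (simp_all add: B_def translate_def)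
qed (simp_all add: B_def translate_def)

lemma interp_S_of_S':
  fixes B :: "(S'_op, 'a) univ_algebra"
  assumes B: "is_algebra S'_arity B"
  defines "A \<equiv> translate S_arity S_op_in_S' B"
  shows "interp A SAnd [x, y] = interp B Meet [x, y]"
    and "interp A SOr [x, y] = interp B Join [x, y]"
    and "interp A SImp [x, y] = interp B Res [x, y]"
    and "interp A SZero [] = interp B Bot []"
    and "interp A SOne [] = interp B Top []"
    and "x \<in> carrier B \<Longrightarrow> interp A SNeg [x] = interp B Res [x, interp B Bot []]"
proof -
  have "interp B f [x, y] = undefined"
    if "\<not> (x \<in> carrier B \<and> y \<in> carrier B)" "S'_arity f = 2" for f
    using that by (intro is_algebra_undefined[OF B]) simp
  then show "interp A SAnd [x, y] = interp B Meet [x, y]" "interp A SOr [x, y] = interp B Join [x, y]"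
    "interp A SImp [x, y] = interp B Res [x, y]"
    by (simp_all add: A_def translate_def)
qed (simp_all add: A_def translate_def)

lemma translate_in_S'_algebras:
  assumes "A \<in> S_algebras"
  shows "translate S'_arity S'_op_in_S A \<in> S'_algebras"
proof -
  note alg = is_algebra_S[OF assms]
  show ?thesis
    unfolding S'_algebras_def
    \<comment> \<open>The equation for \<open>Fuse\<close> instantiates the free product parameter
      with the product of the translated algebra.\<close>
    using nelson_algebra.three_potent_involutive_cibrl[OF
        nelson_algebra_of_S_algebra[OF assms interp_S'_of_S(6)[OF alg]]]
    by (simp add: interp_S'_of_S[OF alg] is_algebra_translate[OF alg])
qed

lemma translate_in_S_algebras:
  fixes B :: "(S'_op, 'a) univ_algebra"
  assumes "B \<in> S'_algebras"
  shows "translate S_arity S_op_in_S' B \<in> S_algebras"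
proof -
  note alg = is_algebra_S'[OF assms]
  let ?A = "translate S_arity S_op_in_S' B"
  interpret c: three_potent_involutive_cibrl "carrier B"
    "\<lambda>x y. interp B Meet [x, y]" "\<lambda>x y. interp B Join [x, y]"
    "\<lambda>x y. interp B Fuse [x, y]" "\<lambda>x y. interp B Res [x, y]" "interp B Top []" "interp B Bot []"
    using assms unfolding S'_algebras_def by blast
  \<comment> \<open>Soundness was proved for \<open>fm_val\<close>; this carries it to the
    translated algebra. Values stay in the carrier, where the translated \<open>SNeg\<close> is
    known to be \<open>c.neg\<close>.\<close>
  have eval: "eval ?A v (trm_of \<phi>) = c.fm_val v \<phi>" if "range v \<subseteq> carrier B" for v \<phi>
    by (induction \<phi>)
      (simp_all add: interp_S_of_S'[OF alg] c.fm_val_closed[OF that] c.neg_def)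
  have v: "range v \<subseteq> carrier B" if "v \<in> UNIV \<rightarrow> carrier B" for v :: "nat \<Rightarrow> 'a"
    using that by auto
  show ?thesis
    unfolding S_algebras_def
  proof (intro CollectI conjI allI impI ballI)
    show "is_algebra S_arity ?A" by (simp add: is_algebra_translate[OF alg])
    show "eval ?A v (trm_of \<phi>) = interp ?A SOne []"
      if "S_axiom \<phi>" "v \<in> UNIV \<rightarrow> carrier ?A" for \<phi> v
      using that by (simp add: interp_S_of_S'[OF alg] eval v c.fm_val_axiom)
    show "interp ?A SImp [x, x] = interp ?A SOne []" if "x \<in> carrier ?A" for x
      using that by (simp add: interp_S_of_S'[OF alg] c.le_refl)
    show "eval ?A v (trm_of \<phi>) = interp ?A SOne []"
      if "S_rule \<Theta> \<phi>" "v \<in> UNIV \<rightarrow> carrier ?A"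
        "\<forall>\<pi>\<in>set \<Theta>. eval ?A v (trm_of \<pi>) = interp ?A SOne []" for \<Theta> \<phi> v
      using that c.fm_val_rule[of \<Theta> \<phi> v] by (simp add: interp_S_of_S'[OF alg] eval v)
    show "x = y"
      if "x \<in> carrier ?A" "y \<in> carrier ?A"
        "interp ?A SImp [x, y] = interp ?A SOne [] \<and> interp ?A SImp [y, x] = interp ?A SOne []"
      for x y
      using that by (intro c.le_antisym) (simp_all add: interp_S_of_S'[OF alg])
  qed
qed

lemma S_round_trip:
  fixes A :: "(S_op, 'a) univ_algebra"
  assumes "A \<in> S_algebras"
  shows "translate S_arity S_op_in_S' (translate S'_arity S'_op_in_S A) = A"
proof (rule algebra_eqI)
  note alg = is_algebra_S[OF assms]
  note alg' = is_algebra_translate[OF alg term_definitions_S']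
  note interp = interp_S_of_S'[OF alg'] interp_S'_of_S[OF alg]
  show "is_algebra S_arity A" by (rule alg)
  show "is_algebra S_arity (translate S_arity S_op_in_S' (translate S'_arity S'_op_in_S A))"
    by (simp add: is_algebra_translate[OF alg'])
  fix f xs assume xs: "xs \<in> tuples (carrier A) (S_arity f)"
  \<comment> \<open>Only negation returns as a different term. Here \<open>refl\<close> chooses the
    defining term itself as the product parameter.\<close>
  have neg: "interp A SImp [x, interp A SZero []] = interp A SNeg [x]" if "x \<in> carrier A" for x
    using that nelson_algebra.neg_eq_imp_zero[OF nelson_algebra_of_S_algebra[OF assms refl]]
    by simp
  show "interp (translate S_arity S_op_in_S' (translate S'_arity S'_op_in_S A)) f xs = interp A f xs"
    using xs by (cases f) (auto elim!: tuples_1E tuples_2E simp: interp neg)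
qed simp

lemma S'_round_trip:
  fixes B :: "(S'_op, 'a) univ_algebra"
  assumes "B \<in> S'_algebras"
  shows "translate S'_arity S'_op_in_S (translate S_arity S_op_in_S' B) = B"
proof (rule algebra_eqI)
  note alg = is_algebra_S'[OF assms]
  note alg' = is_algebra_translate[OF alg term_definitions_S]
  note interp = interp_S'_of_S[OF alg'] interp_S_of_S'[OF alg]
  show "is_algebra S'_arity B" by (rule alg)
  show "is_algebra S'_arity (translate S'_arity S'_op_in_S (translate S_arity S_op_in_S' B))"
    by (simp add: is_algebra_translate[OF alg'])
  interpret c: three_potent_involutive_cibrl "carrier B"
    "\<lambda>x y. interp B Meet [x, y]" "\<lambda>x y. interp B Join [x, y]"
    "\<lambda>x y. interp B Fuse [x, y]" "\<lambda>x y. interp B Res [x, y]" "interp B Top []" "interp B Bot []"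
    using assms unfolding S'_algebras_def by blast
  fix f xs assume xs: "xs \<in> tuples (carrier B) (S'_arity f)"
  \<comment> \<open>Only the product returns as a different term. With this identification it is
    \<open>c.neg (c.neg p)\<close> for the original product \<open>p\<close>, by
    \<open>c.res_neg\<close>, and involution removes the double negation.\<close>
  have neg: "interp (translate S_arity S_op_in_S' B) SNeg [x] = c.neg x" if "x \<in> carrier B" for x
    using that by (simp add: interp c.neg_def)
  show "interp (translate S'_arity S'_op_in_S (translate S_arity S_op_in_S' B)) f xs = interp B f xs"
    using xs by (cases f)
      (auto elim!: tuples_2E simp: interp(1-11) neg c.res_neg c.involutive)
qed simp

theorem theorem3p10:
  shows "term_equivalent_via S_arity S'_arity
           (S_algebras :: (S_op, 'a) univ_algebra set)
           (S'_algebras :: (S'_op, 'a) univ_algebra set)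
           S'_op_in_S S_op_in_S'"
  by (rule term_equivalent_viaI) (fact term_definitions_S' term_definitions_S
      translate_in_S'_algebras translate_in_S_algebras S_round_trip S'_round_trip)+

end
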